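(* There exist sequences $M\in\mathcal{LC}$ such that the associated weight function $\omega_M$ is a normalized quasianalytic BMT-weight function and such that there is no almost subadditive weight function equivalent to $\omega_M$. In addition, writing $\mu_k:=M_k/M_{k-1}$ for $k\ge 1$, such $M$ can be found in each of the following situations (i.e. for each of (a), (b), (c) there exists a sequence $M\in\mathcal{LC}$ satisfying it such that $\omega_M$ is a normalized quasianalytic BMT-weight function and no almost subadditive weight function is equivalent to $\omega_M$): (a) $\lim_{k\to+\infty}\frac{\mu_k}{k}=0$; (b) $\lim_{k\to+\infty}\frac{\mu_k}{k}=+\infty$; (c) $\liminf_{k\to+\infty}\frac{\mu_k}{k}=0$ and $\limsup_{k\to+\infty}\frac{\mu_k}{k}=+\infty$.
   Context: Here $\mathbb{N}=\{0,1,2,\dots\}$. A weight function is a function $\omega:[0,+\infty)\to[0,+\infty)$ which is non-decreasing and satisfies $\lim_{t\to+\infty}\omega(t)=+\infty$. Two functions $\sigma,\tau:[0,+\infty)\to[0,+\infty)$ are equivalent if $\sigma(t)=O(\tau(t))$ and $\tau(t)=O(\sigma(t))$ as $t\to+\infty$. A weight function $\omega$ is almost subadditive if for every $q>1$ there exists $C_q\ge 1$ such that for all $s,t\ge 0$: $\omega(s+t)\le q(\omega(s)+\omega(t))+C_q$. A BMT-weight function is a function $\omega:[0,+\infty)\to[0,+\infty)$ which is continuous, non-decreasing, with $\omega(0)=0$, and such that $\omega(2t)=O(\omega(t))$ as $t\to+\infty$, $\log(t)=o(\omega(t))$ as $t\to+\infty$, and $t\mapsto\omega(e^t)$ is convex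 on $\mathbb{R}$. It is normalized if $\omega(t)=0$ for all $0\le t\le 1$, and quasianalytic if $\int_1^{\infty}\frac{\omega(t)}{t^2}\,dt=+\infty$. $\mathcal{LC}$ is the set of all sequences $M=(M_j)_{j\in\mathbb{N}}$ of positive real numbers such that $1=M_0\le M_1$, $M_j^2\le M_{j-1}M_{j+1}$ for all $j\ge 1$, and $\lim_{j\to+\infty}(M_j)^{1/j}=+\infty$. For $M\in\mathcal{LC}$ the associated weight function $\omega_M:[0,+\infty)\to[0,+\infty)$ is $\omega_M(t):=\sup_{j\in\mathbb{N}}\log\left(\frac{t^j}{M_j}\right)$ for $t>0$, and $\omega_M(0):=0$. *)

theory Defs
  imports "HOL-Analysis.Analysis" "HOL-Library.Landau_Symbols"
begin

text \<open>
  A function from \<open>[0, \<infinity>)\<close> to \<open>[0, \<infinity>)\<close> is represented by a function \<open>real \<Rightarrow> real\<close> that is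
  nonnegative on \<open>{0..}\<close>; its values at negative arguments are unconstrained and play no role
  in any of the notions below.
\<close>

definition weight_function :: "(real \<Rightarrow> real) \<Rightarrow> bool" where
  "weight_function \<omega> \<longleftrightarrow>
     (\<forall>t\<ge>0. 0 \<le> \<omega> t) \<and> mono_on {0..} \<omega> \<and> filterlim \<omega> at_top at_top"

definition equivalent_weights :: "(real \<Rightarrow> real) \<Rightarrow> (real \<Rightarrow> real) \<Rightarrow> bool" where
  "equivalent_weights \<sigma> \<tau> \<longleftrightarrow> \<sigma> \<in> O[at_top](\<tau>) \<and> \<tau> \<in> O[at_top](\<sigma>)"

definition almost_subadditive :: "(real \<Rightarrow> real) \<Rightarrow> bool" where
  "almost_subadditive \<omega> \<longleftrightarrow>
     (\<forall>q>1. \<exists>C\<ge>1. \<forall>s\<ge>0. \<forall>t\<ge>0. \<omega> (s + t) \<le> q * (\<omega> s + \<omega> t) + C)"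

definition BMT_weight_function :: "(real \<Rightarrow> real) \<Rightarrow> bool" where
  "BMT_weight_function \<omega> \<longleftrightarrow>
     (\<forall>t\<ge>0. 0 \<le> \<omega> t) \<and> continuous_on {0..} \<omega> \<and> mono_on {0..} \<omega> \<and> \<omega> 0 = 0 \<and>
     (\<lambda>t. \<omega> (2 * t)) \<in> O[at_top](\<omega>) \<and>
     (\<lambda>t. ln t) \<in> o[at_top](\<omega>) \<and>
     convex_on UNIV (\<lambda>x. \<omega> (exp x))"

definition normalized_weight :: "(real \<Rightarrow> real) \<Rightarrow> bool" where
  "normalized_weight \<omega> \<longleftrightarrow> (\<forall>t. 0 \<le> t \<and> t \<le> 1 \<longrightarrow> \<omega> t = 0)"

text \<open>
  The integrand is nonnegative whenever \<open>\<omega>\<close> is nonnegative on \<open>{0..}\<close>, so divergence of the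
  integral is expressed by the Lebesgue integral with values in \<open>ennreal\<close>.
\<close>

definition quasianalytic_weight :: "(real \<Rightarrow> real) \<Rightarrow> bool" where
  "quasianalytic_weight \<omega> \<longleftrightarrow> (\<integral>\<^sup>+t\<in>{1..}. ennreal (\<omega> t / t\<^sup>2) \<partial>lborel) = \<infinity>"

definition LC :: "(nat \<Rightarrow> real) set" where
  "LC = {M. (\<forall>j. 0 < M j) \<and> M 0 = 1 \<and> 1 \<le> M 1 \<and>
            (\<forall>j\<ge>1. (M j)\<^sup>2 \<le> M (j - 1) * M (j + 1)) \<and>
            filterlim (\<lambda>j. M j powr (1 / real j)) at_top sequentially}"

text \<open>
  For \<open>M \<in> LC\<close> and \<open>t > 0\<close> the set of values \<open>ln (t ^ j / M j)\<close> is bounded above (the quotients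
  tend to \<open>0\<close>), so the supremum in \<open>real\<close> is the true one; it is nonnegative because of \<open>j = 0\<close>.
\<close>

definition assoc_weight :: "(nat \<Rightarrow> real) \<Rightarrow> real \<Rightarrow> real" where
  "assoc_weight M t = (if t > 0 then (SUP j. ln (t ^ j / M j)) else 0)"

text \<open>Meaningful for \<open>k \<ge> 1\<close> only; it is used only in limits as \<open>k\<close> tends to infinity.\<close>

definition quotient_seq :: "(nat \<Rightarrow> real) \<Rightarrow> nat \<Rightarrow> real" where
  "quotient_seq M k = M k / M (k - 1)"

end

theory Submission
  imports Defs "HOL-Library.Log_Nat"
begin

text \<open>
  Let \<open>N i\<close> be the number of \<open>k \<ge> 1\<close> with \<open>\<mu>\<^sub>k \<le> 2 ^ i\<close>. When all \<open>\<mu>\<^sub>k\<close> are powers of 2, the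
  associated weight satisfies \<open>\<omega> (2 ^ i) = ln 2 * (\<Sum>m<i. N m)\<close>, so all the required properties can be
  read off \<open>N\<close>. Iterating the almost subadditivity inequality with \<open>s = t\<close> and passing to an
  equivalent weight gives \<open>\<omega> (2 ^ (i + n)) \<le> K * 3 ^ n * \<omega> (2 ^ i)\<close> for all large \<open>i\<close> and all \<open>n\<close>, with \<open>K\<close>
  independent of both. This fails if \<open>N\<close> keeps quadrupling along runs of indices starting at \<open>i\<close> of
  length at least a suitable multiple of \<open>ln i\<close>.

  Take \<open>N i = 2 ^ (i + \<beta> * n - d)\<close> for \<open>8 ^ n \<le> i < 8 ^ (n + 1)\<close>, where \<open>d\<close> is a tent function of height \<open>8 * n\<close>
  supported near the start of the block. On the second half of the tent \<open>N\<close> quadruples at each step,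
  whereas \<open>\<mu>\<^sub>k / k\<close> is comparable to \<open>2 ^ (d - \<beta> * n)\<close>; the choices \<open>\<beta> = 9, -1, 4\<close> give (a), (b), (c).
\<close>

section \<open>Divergence criteria, dyadic brackets and unfolding of the associated weight\<close>

lemma filterlim_at_topI_nat:
  fixes f :: "nat \<Rightarrow> real"
  assumes "\<And>A::nat. \<exists>i0. \<forall>i\<ge>i0. real A \<le> f i"
  shows "filterlim f at_top sequentially"
  unfolding filterlim_at_top
proof
  fix Z :: real
  obtain A :: nat where "Z \<le> real A" using real_arch_simple by blast
  moreover obtain i0 where "\<forall>i\<ge>i0. real A \<le> f i" using assms by blast
  ultimately show "\<forall>\<^sub>F i in sequentially. Z \<le> f i"
    unfolding eventually_sequentially by (meson order_trans)
qed

lemma dyadic_bracket: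
  fixes t :: real
  assumes "1 \<le> t"
  obtains i where "2 ^ i \<le> t" "t < 2 ^ Suc i"
proof -
  obtain m where m: "t < 2 ^ m" "\<And>k. k < m \<Longrightarrow> \<not> t < 2 ^ k"
    using real_arch_pow[of 2 t] exists_least_iff[of "\<lambda>m. t < 2 ^ m"] by auto
  with assms obtain i where "m = Suc i" by (cases m) auto
  then show thesis using m(1) m(2)[of i] by (intro that[of i]) auto
qed

lemma assoc_weight_pos: "0 < t \<Longrightarrow> assoc_weight M t = (SUP j. ln (t ^ j / M j))"
  by (simp add: assoc_weight_def)

lemma assoc_weight_nonpos: "t \<le> 0 \<Longrightarrow> assoc_weight M t = 0"
  by (simp add: assoc_weight_def)

section \<open>Associated weights of log-convex sequences\<close>

locale log_convex_weight =
  fixes M :: "nat \<Rightarrow> real"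
  assumes LC: "M \<in> LC"
    and bdd: "0 < t \<Longrightarrow> bdd_above (range (\<lambda>j. ln (t ^ j / M j)))"
begin

lemma M_pos: "0 < M j"
  using LC by (simp add: LC_def)

lemma M_0: "M 0 = 1"
  using LC by (simp add: LC_def)

lemma ln_quotient: "0 < t \<Longrightarrow> ln (t ^ j / M j) = real j * ln t - ln (M j)"
  using M_pos[of j] by (simp add: ln_div ln_realpow)

lemma le_assoc_weight: "0 < t \<Longrightarrow> real j * ln t - ln (M j) \<le> assoc_weight M t"
  using cSUP_upper[of j UNIV "\<lambda>j. ln (t ^ j / M j)"] bdd[of t] by (simp add: assoc_weight_pos ln_quotient)

lemma assoc_weight_le:
  assumes "0 < t" and "\<And>j. real j * ln t - ln (M j) \<le> c"
  shows "assoc_weight M t \<le> c"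
  unfolding assoc_weight_pos[OF assms(1)]
  by (rule cSUP_least) (use assms in \<open>auto simp: ln_quotient\<close>)

lemma assoc_weight_nonneg: "0 \<le> assoc_weight M t"
  using le_assoc_weight[of t 0] by (cases "0 < t") (auto simp: M_0 assoc_weight_def)

lemma assoc_weight_mono: "mono_on {0..} (assoc_weight M)"
proof (rule mono_onI)
  fix s t :: real
  assume st: "s \<in> {0..}" "s \<le> t"
  show "assoc_weight M s \<le> assoc_weight M t"
  proof (cases "s = 0")
    case True
    then show ?thesis using assoc_weight_nonneg by (simp add: assoc_weight_def)
  next
    case False
    with st have "0 < s" "0 < t" by auto
    show ?thesis
    proof (rule assoc_weight_le[OF \<open>0 < s\<close>])
      fix j
      have "real j * ln s \<le> real j * ln t"
        using \<open>0 < s\<close> st by (intro mult_left_mono) auto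
      then show "real j * ln s - ln (M j) \<le> assoc_weight M t"
        using le_assoc_weight[OF \<open>0 < t\<close>, of j] by linarith
    qed
  qed
qed

text \<open>Log-convexity passes \<open>M j \<le> M (Suc j)\<close> on to the next index, starting
  from \<open>M 0 \<le> M 1\<close>.\<close>

lemma M_ge_1: "1 \<le> M j"
proof -
  have step: "M j \<le> M (Suc j)" for j
  proof (induction j)
    case 0
    then show ?case using LC by (simp add: LC_def)
  next
    case (Suc j)
    have "M (Suc j) * M (Suc j) \<le> M j * M (Suc (Suc j))"
      using LC by (auto simp: LC_def power2_eq_square dest!: spec[of _ "Suc j"])
    also have "\<dots> \<le> M (Suc j) * M (Suc (Suc j))"
      using Suc M_pos by (intro mult_right_mono) (auto intro: less_imp_le)
    finally show ?case using M_pos[of "Suc j"] by simp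
  qed
  have "M 0 \<le> M j" by (rule lift_Suc_mono_le[of M, OF step]) simp
  then show ?thesis by (simp add: M_0)
qed

lemma normalized: "normalized_weight (assoc_weight M)"
  unfolding normalized_weight_def
proof (intro allI impI)
  fix t :: real
  assume t: "0 \<le> t \<and> t \<le> 1"
  show "assoc_weight M t = 0"
  proof (cases "t = 0")
    case False
    with t have "0 < t" by simp
    have "assoc_weight M t \<le> 0"
    proof (rule assoc_weight_le[OF \<open>0 < t\<close>])
      fix j
      have "real j * ln t \<le> 0" using t \<open>0 < t\<close> by (simp add: mult_nonneg_nonpos)
      moreover have "0 \<le> ln (M j)" using M_ge_1 by simp
      ultimately show "real j * ln t - ln (M j) \<le> 0" by linarith
    qed
    then show ?thesis using assoc_weight_nonneg[of t] by linarith
  qed (simp add: assoc_weight_def)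
qed

text \<open>After the substitution the weight is a supremum of the affine functions
  \<open>j * x - ln (M j)\<close> of \<open>x\<close>.\<close>

lemma assoc_weight_exp_convex: "convex_on UNIV (\<lambda>x. assoc_weight M (exp x))"
proof (rule convex_onI)
  fix s x y :: real
  assume s: "0 < s" "s < 1"
  let ?z = "(1 - s) *\<^sub>R x + s *\<^sub>R y"
  show "assoc_weight M (exp ?z) \<le> (1 - s) * assoc_weight M (exp x) + s * assoc_weight M (exp y)"
  proof (rule assoc_weight_le)
    fix j
    have "(1 - s) * (real j * x - ln (M j)) \<le> (1 - s) * assoc_weight M (exp x)"
      using le_assoc_weight[of "exp x" j] s by (intro mult_left_mono) auto
    moreover have "s * (real j * y - ln (M j)) \<le> s * assoc_weight M (exp y)"
      using le_assoc_weight[of "exp y" j] s by (intro mult_left_mono) auto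
    ultimately show "real j * ln (exp ?z) - ln (M j)
        \<le> (1 - s) * assoc_weight M (exp x) + s * assoc_weight M (exp y)"
      by (simp add: algebra_simps)
  qed simp
qed simp

text \<open>A finite convex function on the whole real line is continuous, and composing it with
  \<open>ln\<close> covers \<open>{1/2..}\<close>. On \<open>{..1/2}\<close> the weight is
  constantly 0, by normalization and by its value at negative arguments.\<close>

lemma continuous_assoc_weight: "continuous_on UNIV (assoc_weight M)"
proof -
  have "continuous_on UNIV (\<lambda>x. assoc_weight M (exp x))"
    by (rule convex_on_continuous[OF open_UNIV assoc_weight_exp_convex])
  then have "continuous_on {1/2..} (\<lambda>t. assoc_weight M (exp (ln t)))"
    by (rule continuous_on_compose2) (auto intro!: continuous_intros)
  then have right: "continuous_on {1/2..} (assoc_weight M)"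
    by (rule continuous_on_eq) auto
  have left: "continuous_on {..1/2} (assoc_weight M)"
  proof (rule continuous_on_eq[OF continuous_on_const[of _ 0]])
    fix t :: real assume "t \<in> {..1/2}"
    then show "0 = assoc_weight M t"
      using normalized assoc_weight_nonpos[of t] unfolding normalized_weight_def
      by (cases "0 \<le> t") auto
  qed
  have "continuous_on ({..1/2} \<union> {1/2..}) (assoc_weight M)"
    by (intro continuous_on_closed_Un left right) auto
  moreover have "{..1/2} \<union> {1/2..} = (UNIV :: real set)" by auto
  ultimately show ?thesis by simp
qed

lemma ln_smallo_assoc_weight: "(\<lambda>t. ln t) \<in> o[at_top](assoc_weight M)"
proof (rule landau_o.smallI)
  fix c :: real
  assume "0 < c"
  \<comment> \<open>A single term of the supremum suffices: \<open>c * j \<ge> 2\<close> yields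
    \<open>2 * ln t\<close>, and one of the two copies of \<open>ln t\<close> eventually absorbs
    \<open>c * ln (M j)\<close>.\<close>
  obtain j :: nat where j: "2 / c \<le> real j" using real_arch_simple by blast
  have "\<forall>\<^sub>F t in at_top. c * ln (M j) \<le> ln (t::real)"
    using ln_at_top unfolding filterlim_at_top by blast
  moreover have "\<forall>\<^sub>F t in at_top. (1::real) \<le> t" by (rule eventually_ge_at_top)
  ultimately show "\<forall>\<^sub>F t in at_top. norm (ln t) \<le> c * norm (assoc_weight M t)"
  proof eventually_elim
    case (elim t)
    have "2 * ln t \<le> c * real j * ln t"
      using j elim \<open>0 < c\<close> by (intro mult_right_mono) (auto simp: field_simps)
    moreover have "c * (real j * ln t - ln (M j)) \<le> c * assoc_weight M t"
      using le_assoc_weight[of t j] \<open>0 < c\<close> elim by (intro mult_left_mono) auto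
    ultimately have "ln t \<le> c * assoc_weight M t"
      using elim by (simp add: algebra_simps)
    then show ?case using elim assoc_weight_nonneg by simp
  qed
qed

end

section \<open>Sequences with a prescribed dyadic counting function\<close>

locale dyadic_counting =
  fixes N :: "nat \<Rightarrow> nat" and C :: nat
  assumes mono: "mono N"
    and pos: "1 \<le> N 0"
    and growth: "N (Suc i) \<le> C * N i"
    and unbounded: "\<exists>i. k \<le> N i"
begin

text \<open>The exponent of \<open>\<mu>\<^sub>k\<close>, as generalized inverse of
  \<open>N\<close>: with this choice \<open>N i\<close> is exactly the number of
  \<open>k \<ge> 1\<close> with \<open>\<mu>\<^sub>k \<le> 2 ^ i\<close>.\<close>

definition level :: "nat \<Rightarrow> nat" where
  "level k = (LEAST i. k \<le> N i)"

definition M :: "nat \<Rightarrow> real" where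
  "M k = 2 ^ (\<Sum>j\<in>{1..k}. level j)"

lemma level_le_iff: "level k \<le> i \<longleftrightarrow> k \<le> N i"
proof
  assume "level k \<le> i"
  then have "N (level k) \<le> N i" using mono by (simp add: monoD)
  moreover have "k \<le> N (level k)" unfolding level_def using unbounded by (rule LeastI_ex)
  ultimately show "k \<le> N i" by simp
qed (simp add: level_def Least_le)

lemma level_mono: "j \<le> k \<Longrightarrow> level j \<le> level k"
  using level_le_iff[of k "level k"] level_le_iff[of j "level k"] by simp

lemma M_Suc: "M (Suc k) = M k * 2 ^ level (Suc k)"
  by (simp add: M_def power_add)

lemma quotient_seq_M: "1 \<le> k \<Longrightarrow> quotient_seq M k = 2 ^ level k"
  using M_Suc[of "k - 1"] by (simp add: quotient_seq_def M_def)

lemma ln_M: "ln (M k) = ln 2 * (\<Sum>j\<in>{1..k}. real (level j))"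
  by (simp add: M_def ln_realpow)

text \<open>The summand is nonnegative for \<open>j \<le> N i\<close> and negative beyond, so
  stopping at \<open>N i\<close> maximizes the sum.\<close>

lemma sum_level_le:
  "(\<Sum>j\<in>{1..k}. real i - real (level j)) \<le> (\<Sum>j\<in>{1..N i}. real i - real (level j))"
proof (cases "k \<le> N i")
  case True
  then show ?thesis
    by (intro sum_mono2) (auto simp: level_le_iff)
next
  case False
  then have "{1..k} = {1..N i} \<union> {Suc (N i)..k}" by auto
  moreover have "(\<Sum>j\<in>{Suc (N i)..k}. real i - real (level j)) \<le> 0"
  proof (rule sum_nonpos)
    fix j assume "j \<in> {Suc (N i)..k}"
    then have "\<not> level j \<le> i" by (simp add: level_le_iff)
    then show "real i - real (level j) \<le> 0" by simp
  qed
  ultimately show ?thesis by (simp add: sum.union_disjoint)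
qed

text \<open>Double counting: \<open>i - level j\<close> is the number of \<open>m < i\<close> with
  \<open>level j \<le> m\<close>, that is, with \<open>j \<le> N m\<close>. In the induction the new
  indices have level exactly \<open>Suc i\<close> and contribute 0, while each of the
  \<open>N i\<close> old ones gains 1.\<close>

lemma sum_level_eq: "(\<Sum>j\<in>{1..N i}. real i - real (level j)) = (\<Sum>m<i. real (N m))"
proof (induction i)
  case 0
  then show ?case by (auto intro!: sum.neutral simp: level_le_iff simp flip: le_zero_eq)
next
  case (Suc i)
  have "(\<Sum>j\<in>{1..N (Suc i)}. real (Suc i) - real (level j)) = (\<Sum>j\<in>{1..N i}. real (Suc i) - real (level j))"
  proof (rule sum.mono_neutral_right)
    show "{1..N i} \<subseteq> {1..N (Suc i)}" using mono by (auto simp: mono_iff_le_Suc intro: order_trans)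
    show "\<forall>j\<in>{1..N (Suc i)} - {1..N i}. real (Suc i) - real (level j) = 0"
    proof
      fix j assume "j \<in> {1..N (Suc i)} - {1..N i}"
      then have "level j \<le> Suc i" "\<not> level j \<le> i" by (auto simp: level_le_iff)
      then show "real (Suc i) - real (level j) = 0" by simp
    qed
  qed simp
  also have "\<dots> = (\<Sum>j\<in>{1..N i}. (real i - real (level j)) + 1)"
    by (intro sum.cong) auto
  also have "\<dots> = (\<Sum>j\<in>{1..N i}. real i - real (level j)) + real (N i)"
    by (subst sum.distrib) simp
  finally show ?case using Suc by simp
qed

lemma ln_term_dyadic:
  "real j * ln (2 ^ i) - ln (M j) = ln 2 * (\<Sum>k\<in>{1..j}. real i - real (level k))"
  by (simp add: ln_realpow ln_M sum_subtractf algebra_simps)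

text \<open>The bound is uniform in \<open>j\<close>. It serves three times: for the growth of the
  roots of \<open>M\<close>, for boundedness of the supremum, and for the upper half of its value at
  \<open>2 ^ i\<close>.\<close>

lemma ln_term_le:
  assumes "0 < t" "t \<le> 2 ^ i"
  shows "real j * ln t - ln (M j) \<le> ln 2 * (\<Sum>m<i. real (N m))"
proof -
  have "real j * ln t \<le> real j * ln (2 ^ i)"
    using assms by (intro mult_left_mono) (auto simp del: ln_realpow)
  then have "real j * ln t - ln (M j) \<le> real j * ln (2 ^ i) - ln (M j)" by simp
  also have "\<dots> \<le> ln 2 * (\<Sum>m<i. real (N m))"
    unfolding ln_term_dyadic using sum_level_le[of i j] unfolding sum_level_eq by simp
  finally show ?thesis .
qed

lemma M_gt_0: "0 < M k"
  by (simp add: M_def)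

lemma M_in_LC: "M \<in> LC"
proof -
  have "(M j)\<^sup>2 \<le> M (j - 1) * M (j + 1)" if "1 \<le> j" for j
  proof -
    have "2 ^ level j \<le> (2::real) ^ level (Suc j)" by (simp add: level_mono)
    then have "M (j - 1) * 2 ^ level j * (M (j - 1) * 2 ^ level j)
        \<le> M (j - 1) * (M (j - 1) * 2 ^ level j * 2 ^ level (Suc j))"
      using M_gt_0[of "j - 1"] by simp
    then show ?thesis
      using M_Suc[of "j - 1"] M_Suc[of j] that by (simp add: power2_eq_square)
  qed
  moreover have "filterlim (\<lambda>j. M j powr (1 / real j)) at_top sequentially"
  proof (rule filterlim_at_topI_nat)
    fix A :: nat
    \<comment> \<open>\<open>?K\<close> bounds all terms at \<open>2 ^ Suc A\<close>. The exponent
      \<open>Suc A\<close> leaves a spare \<open>j * ln 2\<close>, which absorbs \<open>?K\<close>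
      for large \<open>j\<close>, so that \<open>M j \<ge> 2 ^ (A * j)\<close> remains.\<close>
    let ?K = "ln 2 * (\<Sum>m<Suc A. real (N m))"
    obtain j0 :: nat where j0: "?K / ln 2 \<le> real j0" using real_arch_simple by blast
    show "\<exists>i0. \<forall>j\<ge>i0. real A \<le> M j powr (1 / real j)"
    proof (intro exI allI impI)
      fix j assume j: "Suc j0 \<le> j"
      then have "?K / ln 2 \<le> real j" using j0 by linarith
      then have "?K \<le> ln 2 * real j" by (simp add: divide_le_eq mult.commute)
      moreover have "real j * ln (2 ^ Suc A) - ln (M j) \<le> ?K"
        by (rule ln_term_le) auto
      moreover have "ln (2 ^ Suc A :: real) = real A * ln 2 + ln 2"
        by (subst ln_realpow) (simp_all add: distrib_right)
      ultimately have "real j * (real A * ln 2) \<le> ln (M j)"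
        by (simp only: distrib_left mult.commute[of "ln 2" "real j"])
      then have "real A * ln 2 \<le> 1 / real j * ln (M j)"
        using j by (simp add: field_simps)
      then have "exp (real A * ln 2) \<le> M j powr (1 / real j)"
        using M_gt_0[of j] by (simp add: powr_def)
      moreover have "exp (real A * ln 2) = 2 ^ A" by (simp add: exp_of_nat_mult)
      moreover have "real A \<le> 2 ^ A" using of_nat_less_two_power[of A] by simp
      ultimately show "real A \<le> M j powr (1 / real j)" by linarith
    qed
  qed
  moreover have "1 \<le> M 1" "M 0 = 1" by (simp_all add: M_def)
  ultimately show ?thesis by (simp add: LC_def M_gt_0)
qed

sublocale log_convex_weight M
proof
  show "M \<in> LC" by (rule M_in_LC)
  fix t :: real
  assume "0 < t"
  obtain i where "t < 2 ^ i" using real_arch_pow[of 2 t] by auto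
  then show "bdd_above (range (\<lambda>j. ln (t ^ j / M j)))"
    using ln_term_le[OF \<open>0 < t\<close>, of i] M_gt_0 \<open>0 < t\<close>
    by (intro bdd_aboveI2[where M = "ln 2 * (\<Sum>m<i. real (N m))"])
      (simp add: ln_div ln_realpow less_imp_neq[THEN not_sym])
qed

text \<open>The supremum is attained at \<open>j = N i\<close>, where the summands change
  sign.\<close>

lemma assoc_weight_dyadic: "assoc_weight M (2 ^ i) = ln 2 * (\<Sum>m<i. real (N m))"
proof (rule antisym)
  show "assoc_weight M (2 ^ i) \<le> ln 2 * (\<Sum>m<i. real (N m))"
    by (rule assoc_weight_le) (auto intro!: ln_term_le simp del: ln_realpow)
  show "ln 2 * (\<Sum>m<i. real (N m)) \<le> assoc_weight M (2 ^ i)"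
    using le_assoc_weight[of "2 ^ i" "N i"] unfolding ln_term_dyadic sum_level_eq by simp
qed

section \<open>Doubling and the BMT properties\<close>

lemma assoc_weight_dyadic_Suc:
  assumes "1 \<le> i"
  shows "assoc_weight M (2 ^ Suc i) \<le> (real C + 1) * assoc_weight M (2 ^ i)"
proof -
  have "real (N (Suc m)) \<le> real C * real (N m)" for m
    using growth[of m] by (metis of_nat_le_iff of_nat_mult)
  \<comment> \<open>After the index shift only \<open>N 0\<close> has no predecessor; since
    \<open>i \<ge> 1\<close>, it is itself a summand of the old sum, which accounts for the
    \<open>+ 1\<close>.\<close>
  then have "(\<Sum>m<Suc i. real (N m)) \<le> real (N 0) + (\<Sum>m<i. real C * real (N m))"
    unfolding sum.lessThan_Suc_shift by (intro add_left_mono sum_mono)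
  also have "real (N 0) \<le> (\<Sum>m<i. real (N m))"
    using member_le_sum[of 0 "{..<i}" "\<lambda>m. real (N m)"] assms by simp
  finally have "(\<Sum>m<Suc i. real (N m)) \<le> (real C + 1) * (\<Sum>m<i. real (N m))"
    by (simp add: algebra_simps flip: sum_distrib_left)
  then have "ln 2 * (\<Sum>m<Suc i. real (N m)) \<le> ln 2 * ((real C + 1) * (\<Sum>m<i. real (N m)))"
    by (intro mult_left_mono) auto
  then show ?thesis unfolding assoc_weight_dyadic by (simp only: mult.left_commute)
qed

lemma assoc_weight_doubling: "(\<lambda>t. assoc_weight M (2 * t)) \<in> O[at_top](assoc_weight M)"
proof (rule landau_o.bigI)
  show "0 < (real C + 1) * (real C + 1)" by simp
  \<comment> \<open>From 2 on, the bracketing exponent of \<open>t\<close> is at least 1. As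
    \<open>2 * t < 2 ^ (i + 2)\<close> while \<open>2 ^ i \<le> t\<close>, two dyadic steps are
    needed, hence the squared constant.\<close>
  have "\<forall>\<^sub>F t in at_top. (2::real) \<le> t" by (rule eventually_ge_at_top)
  then show "\<forall>\<^sub>F t in at_top. norm (assoc_weight M (2 * t))
      \<le> (real C + 1) * (real C + 1) * norm (assoc_weight M t)"
  proof eventually_elim
    case (elim t)
    obtain i where i: "2 ^ i \<le> t" "t < 2 ^ Suc i"
      using dyadic_bracket elim by (metis order_trans one_le_numeral)
    with elim have "1 \<le> i" by (cases i) auto
    have "assoc_weight M (2 * t) \<le> assoc_weight M (2 ^ Suc (Suc i))"
      using elim i by (intro mono_onD[OF assoc_weight_mono]) auto
    also have "\<dots> \<le> (real C + 1) * assoc_weight M (2 ^ Suc i)"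
      by (rule assoc_weight_dyadic_Suc) simp
    also have "\<dots> \<le> (real C + 1) * ((real C + 1) * assoc_weight M (2 ^ i))"
      by (intro mult_left_mono assoc_weight_dyadic_Suc \<open>1 \<le> i\<close>) simp
    also have "\<dots> \<le> (real C + 1) * ((real C + 1) * assoc_weight M t)"
      using elim i by (intro mult_left_mono mono_onD[OF assoc_weight_mono]) auto
    finally show ?case using assoc_weight_nonneg by (simp add: mult.assoc)
  qed
qed

lemma BMT: "BMT_weight_function (assoc_weight M)"
  unfolding BMT_weight_function_def
  using assoc_weight_nonneg continuous_on_subset[OF continuous_assoc_weight] assoc_weight_mono assoc_weight_doubling
    ln_smallo_assoc_weight assoc_weight_exp_convex
  by (auto simp: assoc_weight_def)

section \<open>Quasianalyticity\<close>

text \<open>On \<open>[2 ^ (i + 1), 2 ^ (i + 2))\<close> the weight is at least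
  \<open>ln 2 * N i\<close> and \<open>t\<^sup>2\<close> at most \<open>4 ^ (i + 2)\<close>.
  Multiplying by the length \<open>2 ^ (i + 1)\<close> shows that the integral dominates
  \<open>ln 2 / 8\<close> times the series of \<open>N i / 2 ^ i\<close>.\<close>

lemma quasianalytic:
  assumes "\<And>B. \<exists>m. B \<le> (\<Sum>i<m. real (N i) / 2 ^ i)"
  shows "quasianalytic_weight (assoc_weight M)"
proof -
  let ?f = "\<lambda>t. ennreal (assoc_weight M t / t\<^sup>2)"
  let ?I = "\<integral>\<^sup>+t\<in>{1..}. ?f t \<partial>lborel"
  have [measurable]: "assoc_weight M \<in> borel_measurable borel"
    by (rule borel_measurable_continuous_onI[OF continuous_assoc_weight])
  have block: "ennreal (ln 2 / 8 * (real (N i) / 2 ^ i))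
      \<le> (\<integral>\<^sup>+t\<in>{2 ^ Suc i..<2 ^ Suc (Suc i)}. ?f t \<partial>lborel)" for i
  proof -
    let ?A = "{2 ^ Suc i..<2 ^ Suc (Suc i)} :: real set"
    let ?c = "ln 2 * real (N i) / (2 ^ Suc (Suc i))\<^sup>2 :: real"
    have "emeasure lborel ?A = ennreal (2 ^ Suc i)"
      by (subst emeasure_lborel_Ico) auto
    moreover have "?c * 2 ^ Suc i = ln 2 / 8 * (real (N i) / 2 ^ i)"
      by (simp add: field_simps power2_eq_square)
    ultimately have "ennreal (ln 2 / 8 * (real (N i) / 2 ^ i)) = (\<integral>\<^sup>+t\<in>?A. ennreal ?c \<partial>lborel)"
      by (simp add: nn_integral_cmult_indicator flip: ennreal_mult)
    also have "\<dots> \<le> (\<integral>\<^sup>+t\<in>?A. ?f t \<partial>lborel)"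
    proof (rule nn_integral_mono)
      fix t :: real
      have "?c \<le> assoc_weight M t / t\<^sup>2" if t: "t \<in> ?A"
      proof (rule frac_le)
        have "0 < t" using t by (auto intro: less_le_trans[of _ "2 ^ Suc i"])
        then show "0 < t\<^sup>2" by simp
        show "t\<^sup>2 \<le> (2 ^ Suc (Suc i))\<^sup>2" using t \<open>0 < t\<close> by (intro power_mono) auto
        have "ln 2 * real (N i) \<le> assoc_weight M (2 ^ Suc i)"
          unfolding assoc_weight_dyadic by (simp add: sum_nonneg)
        also have "\<dots> \<le> assoc_weight M t"
          using t \<open>0 < t\<close> by (intro mono_onD[OF assoc_weight_mono]) auto
        finally show "ln 2 * real (N i) \<le> assoc_weight M t" .
      qed (rule assoc_weight_nonneg)
      then show "ennreal ?c * indicator ?A t \<le> ?f t * indicator ?A t"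
        by (auto simp: indicator_def intro: ennreal_leI)
    qed
    finally show ?thesis .
  qed
  have partial: "ennreal (ln 2 / 8 * (\<Sum>i<m. real (N i) / 2 ^ i)) \<le> (\<integral>\<^sup>+t\<in>{2..<2 ^ Suc m}. ?f t \<partial>lborel)" for m
  proof (induction m)
    case (Suc m)
    have "ennreal (ln 2 / 8 * (\<Sum>i<Suc m. real (N i) / 2 ^ i))
        = ennreal (ln 2 / 8 * (\<Sum>i<m. real (N i) / 2 ^ i)) + ennreal (ln 2 / 8 * (real (N m) / 2 ^ m))"
      by (subst ennreal_plus[symmetric]) (auto simp: sum_nonneg distrib_left)
    also have "\<dots> \<le> (\<integral>\<^sup>+t\<in>{2..<2 ^ Suc m}. ?f t \<partial>lborel)
        + (\<integral>\<^sup>+t\<in>{2 ^ Suc m..<2 ^ Suc (Suc m)}. ?f t \<partial>lborel)"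
      by (intro add_mono Suc block)
    also have "\<dots> = (\<integral>\<^sup>+t\<in>{2..<2 ^ Suc m} \<union> {2 ^ Suc m..<2 ^ Suc (Suc m)}. ?f t \<partial>lborel)"
      by (rule nn_integral_disjoint_pair[symmetric]) auto
    also have "{2..<2 ^ Suc m} \<union> {2 ^ Suc m..<2 ^ Suc (Suc m)} = {2..<2 ^ Suc (Suc m) :: real}"
      by (rule ivl_disj_un_two) (auto simp: self_le_power)
    finally show ?case .
  qed simp
  have "of_nat n \<le> ?I" for n
  proof -
    obtain m where m: "8 / ln 2 * real n \<le> (\<Sum>i<m. real (N i) / 2 ^ i)" using assms by blast
    have "ennreal (real n) \<le> ennreal (ln 2 / 8 * (\<Sum>i<m. real (N i) / 2 ^ i))"
      using m by (intro ennreal_leI) (simp add: field_simps)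
    also note partial
    also have "(\<integral>\<^sup>+t\<in>{2..<2 ^ Suc m}. ?f t \<partial>lborel) \<le> ?I"
      by (intro nn_integral_mono) (auto simp: indicator_def)
    finally show ?thesis by (simp add: ennreal_of_nat_eq_real_of_nat)
  qed
  then have "?I = top"
    using ennreal_Ex_less_of_nat[of ?I] by (meson leD top.not_eq_extremum)
  then show ?thesis by (simp add: quasianalytic_weight_def)
qed

section \<open>Obstruction to almost subadditive equivalent weights\<close>

lemma no_almost_subadditive:
  assumes steep: "\<And>K i0. \<exists>i\<ge>i0. \<exists>n. K * 3 ^ Suc n * (real i * real (N i)) < real (N (i + n))"
  shows "\<nexists>\<sigma>. weight_function \<sigma> \<and> almost_subadditive \<sigma> \<and> equivalent_weights \<sigma> (assoc_weight M)"
proof (intro notI, elim exE conjE)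
  fix \<sigma>
  assume \<sigma>: "weight_function \<sigma>" "almost_subadditive \<sigma>" "equivalent_weights \<sigma> (assoc_weight M)"
  have nonneg: "0 \<le> \<sigma> t" if "0 \<le> t" for t
    using \<sigma>(1) that by (simp add: weight_function_def)
  obtain A where A: "0 < A" "\<forall>\<^sub>F t in at_top. norm (\<sigma> t) \<le> A * norm (assoc_weight M t)"
    using \<sigma>(3) unfolding equivalent_weights_def by (auto elim!: landau_o.bigE)
  obtain B where B: "0 < B" "\<forall>\<^sub>F t in at_top. norm (assoc_weight M t) \<le> B * norm (\<sigma> t)"
    using \<sigma>(3) unfolding equivalent_weights_def by (auto elim!: landau_o.bigE)
  \<comment> \<open>With \<open>q = 5/4\<close> and \<open>s = t\<close> the factor is
    \<open>5/2\<close>; where \<open>\<sigma> \<ge> 2 * D\<close> the constant costs at most another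
    \<open>1/2\<close>. The resulting factor 3 per doubling stays below the 4 that \<open>N\<close>
    can reach.\<close>
  obtain D where D: "\<And>s t. 0 \<le> s \<Longrightarrow> 0 \<le> t \<Longrightarrow> \<sigma> (s + t) \<le> 5/4 * (\<sigma> s + \<sigma> t) + D"
    using \<sigma>(2)[unfolded almost_subadditive_def, rule_format, of "5/4"] by auto
  have "\<forall>\<^sub>F t in at_top. 2 * D \<le> \<sigma> t"
    using \<sigma>(1) unfolding weight_function_def filterlim_at_top by blast
  with A(2) B(2) have "\<forall>\<^sub>F t in at_top. norm (\<sigma> t) \<le> A * norm (assoc_weight M t)
      \<and> norm (assoc_weight M t) \<le> B * norm (\<sigma> t) \<and> 2 * D \<le> \<sigma> t"
    by eventually_elim auto
  then obtain T where T: "\<And>t. T \<le> t \<Longrightarrow> norm (\<sigma> t) \<le> A * norm (assoc_weight M t)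
      \<and> norm (assoc_weight M t) \<le> B * norm (\<sigma> t) \<and> 2 * D \<le> \<sigma> t"
    unfolding eventually_at_top_linorder by blast
  obtain i0 where i0: "T < 2 ^ i0" using real_arch_pow[of 2 T] by auto
  have large: "T \<le> 2 ^ i" if "i0 \<le> i" for i
    using i0 power_increasing[OF that, of "2::real"] by linarith
  have iter: "\<sigma> (2 ^ (i + n)) \<le> 3 ^ n * \<sigma> (2 ^ i)" if "i0 \<le> i" for i n
  proof (induction n)
    case (Suc n)
    have "\<sigma> (2 ^ (i + Suc n)) \<le> 5/4 * (\<sigma> (2 ^ (i + n)) + \<sigma> (2 ^ (i + n))) + D"
      using D[of "2 ^ (i + n)" "2 ^ (i + n)"] by simp
    also have "\<dots> \<le> 3 * \<sigma> (2 ^ (i + n))"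
      using T[OF large, of "i + n"] that by simp
    finally show ?case using Suc by simp
  qed simp
  \<comment> \<open>\<open>A * B\<close> pays for the two passages between \<open>\<sigma>\<close>
    and the associated weight. The power is \<open>Suc n\<close> because \<open>N (i + n)\<close>
    first occurs as a summand at \<open>2 ^ (i + Suc n)\<close>.\<close>
  obtain i n where i: "i0 \<le> i" and steep_i: "A * B * 3 ^ Suc n * (real i * real (N i)) < real (N (i + n))"
    using steep by blast
  have "ln 2 * real (N (i + n)) \<le> assoc_weight M (2 ^ (i + Suc n))"
    unfolding assoc_weight_dyadic by (simp add: sum_nonneg)
  also have "\<dots> \<le> B * \<sigma> (2 ^ (i + Suc n))"
    using T[OF large, of "i + Suc n"] i assoc_weight_nonneg nonneg by simp
  also have "\<dots> \<le> B * (3 ^ Suc n * \<sigma> (2 ^ i))"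
    using B(1) iter[OF i, of "Suc n"] by (intro mult_left_mono) auto
  also have "\<dots> \<le> B * (3 ^ Suc n * (A * assoc_weight M (2 ^ i)))"
    using B(1) T[OF large[OF i]] assoc_weight_nonneg nonneg by (intro mult_left_mono) auto
  also have "\<dots> = ln 2 * (A * B * 3 ^ Suc n * (\<Sum>m<i. real (N m)))"
    by (simp add: assoc_weight_dyadic)
  also have "\<dots> \<le> ln 2 * (A * B * 3 ^ Suc n * (real i * real (N i)))"
  proof (intro mult_left_mono)
    show "(\<Sum>m<i. real (N m)) \<le> real i * real (N i)"
      using sum_bounded_above[of "{..<i}" "\<lambda>m. real (N m)" "real (N i)"] mono by (simp add: monoD)
  qed (use A B in auto)
  finally show False using steep_i by simp
qed

section \<open>From the counting function to the quotients \<open>\<mu>\<^sub>k / k\<close>\<close>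

lemma level_at_top: "filterlim level at_top sequentially"
  unfolding filterlim_at_top eventually_sequentially
proof
  fix i
  show "\<exists>k0. \<forall>k\<ge>k0. i \<le> level k"
  proof (intro exI allI impI)
    fix k assume "Suc (N i) \<le> k"
    then have "\<not> level k \<le> i" by (simp add: level_le_iff)
    then show "i \<le> level k" by simp
  qed
qed

lemma le_N_level: "k \<le> N (level k)"
  using level_le_iff by blast

lemma N_gt_0: "0 < N i"
  using pos monoD[OF mono, of 0 i] by simp

text \<open>If \<open>level k = Suc i\<close>, then \<open>N i < k\<close>, so
  \<open>\<mu>\<^sub>k / k\<close> is at most \<open>2 * (2 ^ i / N i)\<close>.\<close>

lemma quotient_tendsto_0:
  assumes "(\<lambda>i. 2 ^ i / real (N i)) \<longlonglongrightarrow> 0"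
  shows "(\<lambda>k. quotient_seq M k / real k) \<longlonglongrightarrow> 0"
proof (rule real_tendsto_sandwich[OF _ _ tendsto_const])
  have "filterlim (\<lambda>k. level k - 1) at_top sequentially"
    by (rule filterlim_compose[OF filterlim_minus_const_nat_at_top level_at_top])
  then have "(\<lambda>k. 2 * (2 ^ (level k - 1) / real (N (level k - 1)))) \<longlonglongrightarrow> 2 * 0"
    by (intro tendsto_mult_left filterlim_compose[OF assms])
  then show "(\<lambda>k. 2 * (2 ^ (level k - 1) / real (N (level k - 1)))) \<longlonglongrightarrow> 0" by simp
  show "\<forall>\<^sub>F k in sequentially. quotient_seq M k / real k \<le> 2 * (2 ^ (level k - 1) / real (N (level k - 1)))"
    \<comment> \<open>Beyond \<open>N 0\<close> the level is positive, so \<open>level k - 1\<close>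
      is a true predecessor.\<close>
    using eventually_gt_at_top[of "N 0"]
  proof eventually_elim
    case (elim k)
    then have "\<not> level k \<le> 0" unfolding level_le_iff by simp
    then obtain i where i: "level k = Suc i" using not0_implies_Suc by blast
    then have "\<not> level k \<le> i" by simp
    then have "N i < k" by (simp add: level_le_iff)
    have "2 ^ Suc i / real k \<le> 2 ^ Suc i / real (N i)"
      using \<open>N i < k\<close> N_gt_0[of i] by (intro divide_left_mono) auto
    then show ?case using elim i by (simp add: quotient_seq_M)
  qed
qed (auto intro!: always_eventually simp: quotient_seq_def M_gt_0 less_imp_le)

lemma quotient_at_top:
  assumes "filterlim (\<lambda>i. 2 ^ i / real (N i)) at_top sequentially"
  shows "filterlim (\<lambda>k. quotient_seq M k / real k) at_top sequentially"
proof (rule filterlim_at_top_mono)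
  show "filterlim (\<lambda>k. 2 ^ level k / real (N (level k))) at_top sequentially"
    by (rule filterlim_compose[OF assms level_at_top])
  show "\<forall>\<^sub>F k in sequentially. 2 ^ level k / real (N (level k)) \<le> quotient_seq M k / real k"
    using eventually_ge_at_top[of 1]
  proof eventually_elim
    case (elim k)
    then show ?case
      using le_N_level[of k] N_gt_0[of "level k"] by (simp add: quotient_seq_M divide_left_mono)
  qed
qed

lemma N_at_top: "\<exists>i0. \<forall>i\<ge>i0. k \<le> N i"
  using unbounded[of k] mono by (meson monoD order_trans)

text \<open>The test indices are \<open>k = N i\<close>, the last ones with
  \<open>\<mu>\<^sub>k \<le> 2 ^ i\<close>.\<close>

lemma liminf_quotient_0:
  assumes "\<And>e i0. 0 < e \<Longrightarrow> \<exists>i\<ge>i0. 2 ^ i / real (N i) < e"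
  shows "liminf (\<lambda>k. ereal (quotient_seq M k / real k)) = 0"
proof (rule ccontr)
  let ?l = "liminf (\<lambda>k. ereal (quotient_seq M k / real k))"
  assume "?l \<noteq> 0"
  moreover have "0 \<le> ?l"
    by (rule Liminf_bounded) (auto intro!: always_eventually simp: quotient_seq_def M_gt_0 less_imp_le)
  ultimately have "0 < ?l" by simp
  then obtain e where e: "0 < ereal e" "ereal e < ?l" using ereal_dense2 by blast
  from less_LiminfD[OF e(2)] obtain k0 where k0: "\<And>k. k0 \<le> k \<Longrightarrow> e < quotient_seq M k / real k"
    unfolding eventually_sequentially by auto
  obtain i0 where i0: "\<And>i. i0 \<le> i \<Longrightarrow> k0 \<le> N i" using N_at_top by blast
  obtain i where i: "i0 \<le> i" "2 ^ i / real (N i) < e" using assms[of e i0] e(1) by auto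
  have "quotient_seq M (N i) / real (N i) \<le> 2 ^ i / real (N i)"
    using N_gt_0[of i] by (simp add: quotient_seq_M level_le_iff divide_right_mono Suc_leI)
  then show False using i k0[OF i0[OF i(1)]] by simp
qed

text \<open>The test indices are \<open>k = N i + 1\<close>, the first ones with
  \<open>\<mu>\<^sub>k \<ge> 2 ^ (i + 1)\<close>; the extra factor 2 pays for
  \<open>N i + 1 \<le> 2 * N i\<close>.\<close>

lemma limsup_quotient_infinity:
  assumes "\<And>K i0. \<exists>i\<ge>i0. K < 2 ^ i / real (N i)"
  shows "limsup (\<lambda>k. ereal (quotient_seq M k / real k)) = \<infinity>"
proof (rule ccontr)
  let ?l = "limsup (\<lambda>k. ereal (quotient_seq M k / real k))"
  assume "?l \<noteq> \<infinity>"
  then have "?l < \<infinity>" by simp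
  then obtain K where K: "?l < ereal K" using ereal_dense2 by blast
  from Limsup_lessD[OF K] obtain k0 where k0: "\<And>k. k0 \<le> k \<Longrightarrow> quotient_seq M k / real k < K"
    unfolding eventually_sequentially by auto
  obtain i0 where i0: "\<And>i. i0 \<le> i \<Longrightarrow> k0 \<le> N i" using N_at_top by blast
  obtain i where i: "i0 \<le> i" "K < 2 ^ i / real (N i)" using assms by blast
  have "\<not> level (Suc (N i)) \<le> i" by (simp add: level_le_iff)
  then have "(2::real) ^ Suc i \<le> 2 ^ level (Suc (N i))" by (intro power_increasing) auto
  moreover have "2 ^ i / real (N i) \<le> 2 ^ Suc i / real (Suc (N i))"
    using N_gt_0[of i] by (simp add: field_simps Suc_leI)
  ultimately have "K < quotient_seq M (Suc (N i)) / real (Suc (N i))"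
    using i(2) divide_right_mono[of "2 ^ Suc i" "2 ^ level (Suc (N i))" "real (Suc (N i))"]
    by (simp add: quotient_seq_M)
  then show False using i k0[of "Suc (N i)"] i0[OF i(1)] by simp
qed

end

section \<open>The concrete counting function: blocks between powers of 8, and tents\<close>

text \<open>\<open>floorlog 8 i\<close> is the number of octal digits of \<open>i\<close>, so this
  is the integer part of the base 8 logarithm for \<open>i > 0\<close>; at \<open>i = 0\<close>
  truncated subtraction gives 0.\<close>

definition block :: "nat \<Rightarrow> nat" where
  "block i = floorlog 8 i - 1"

text \<open>The tent: slopes 1 and -1, support from \<open>8 ^ n\<close> to
  \<open>8 ^ n + 16 * n\<close>, peak \<open>8 * n\<close> in the middle.\<close>

definition dip :: "nat \<Rightarrow> nat \<Rightarrow> int" where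
  "dip n i = max 0 (8 * int n - \<bar>int i - 8 ^ n - 8 * int n\<bar>)"

definition expo :: "int \<Rightarrow> nat \<Rightarrow> int" where
  "expo \<beta> i = int i + \<beta> * int (block i) - dip (block i) i"

text \<open>The conversion by \<open>nat\<close> is faithful for \<open>\<beta> \<ge> -1\<close>, by
  \<open>expo_nonneg\<close> below.\<close>

definition dyadic_count :: "int \<Rightarrow> nat \<Rightarrow> nat" where
  "dyadic_count \<beta> i = 2 ^ nat (expo \<beta> i)"

lemma block_eq:
  assumes "8 ^ n \<le> i" "i < 8 ^ Suc n"
  shows "block i = n"
proof -
  have "floorlog 8 i \<le> Suc n" using assms by (intro floorlog_leI) auto
  moreover have "Suc n \<le> floorlog 8 i" using assms by (intro floorlog_ge_SucI) auto
  ultimately show ?thesis by (simp add: block_def)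
qed

lemma block_bounds:
  assumes "0 < i"
  shows "8 ^ block i \<le> i" "i < 8 ^ Suc (block i)"
proof -
  have "floorlog 8 i \<noteq> 0" using assms by (simp add: floorlog_eq_zero_iff)
  then show "8 ^ block i \<le> i" "i < 8 ^ Suc (block i)"
    using floorlog_bounds[of i 8] assms by (simp_all add: block_def)
qed

lemma block_at_top: "filterlim block at_top sequentially"
  unfolding filterlim_at_top eventually_sequentially
proof
  fix n
  show "\<exists>i0. \<forall>i\<ge>i0. n \<le> block i"
  proof (intro exI allI impI)
    fix i :: nat assume "8 ^ n \<le> i"
    then have "Suc n \<le> floorlog 8 i" by (intro floorlog_ge_SucI) auto
    then show "n \<le> block i" by (simp add: block_def)
  qed
qed

text \<open>The n-th block has \<open>7 * 8 ^ n\<close> indices, so at least \<open>4 ^ n\<close> of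
  them lie behind the tent.\<close>

lemma block_length: "16 * int n + 4 ^ n \<le> 7 * 8 ^ n"
proof (induction n)
  case (Suc n)
  have "16 * (1 + k) + 4 * x \<le> 7 * (8 * y)" if "16 * k + x \<le> 7 * y" "1 \<le> y" "0 \<le> k" for k x y :: int
    using that by presburger
  from this[OF Suc] show ?case by simp
qed simp

lemma dip_fits: "16 * int n < 7 * 8 ^ n"
  using block_length[of n] zero_less_power[of "4::int" n] by linarith

lemma less_8_power: "2 * int n < 8 ^ n"
  by (induction n) auto

lemma le_8_power: "n \<le> (8::nat) ^ n"
  by (rule less_imp_le[OF power_gt_expt]) simp

lemma dip_nonneg: "0 \<le> dip n i"
  by (simp add: dip_def)

lemma dip_le:
  assumes "8 ^ n \<le> i"
  shows "dip n i \<le> int i - 8 ^ n"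
proof -
  have "8 ^ n \<le> int i" using assms by (metis of_nat_le_iff of_nat_numeral of_nat_power)
  then show ?thesis unfolding dip_def by linarith
qed

lemma dip_le_depth: "dip n i \<le> 8 * int n"
  by (auto simp: dip_def)

lemma dip_eq_0: "8 ^ n + 16 * int n \<le> int i \<Longrightarrow> dip n i = 0"
  by (simp add: dip_def)

lemma dip_start: "dip n (8 ^ n) = 0"
  by (simp add: dip_def)

lemma dip_bottom: "dip n (8 ^ n + 8 * n) = 8 * int n"
  by (simp add: dip_def)

lemma dip_step: "\<bar>dip n (Suc i) - dip n i\<bar> \<le> 1"
  by (auto simp: dip_def)

lemma expo_0: "expo \<beta> 0 = 0"
  by (simp add: expo_def block_def floorlog_def dip_def)

text \<open>The tent lies below its rising edge \<open>i - 8 ^ n\<close>, so \<open>i\<close> minus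
  the tent is at least \<open>8 ^ n\<close>, which outweighs the loss of at most \<open>n\<close>
  from a negative \<open>\<beta>\<close>.\<close>

lemma expo_nonneg:
  assumes "-1 \<le> \<beta>"
  shows "0 \<le> expo \<beta> i"
proof (cases "i = 0")
  case False
  then have "dip (block i) i \<le> int i - 8 ^ block i" by (intro dip_le block_bounds) simp
  moreover have "- int (block i) \<le> \<beta> * int (block i)"
    using mult_right_mono[OF assms, of "int (block i)"] by simp
  ultimately show ?thesis
    using less_8_power[of "block i"] by (simp add: expo_def)
qed (simp add: expo_0)

text \<open>Inside a block the increment is 1 minus the tent increment, hence between 0 and 2. Where
  blocks meet, the tents vanish on both sides and the increment is \<open>1 + \<beta>\<close>; this
  dictates the range of \<open>\<beta>\<close> and the growth constant
  \<open>1024 = 2 ^ 10\<close>.\<close>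

lemma expo_step:
  assumes "-1 \<le> \<beta>" "\<beta> \<le> 9"
  shows "expo \<beta> i \<le> expo \<beta> (Suc i)" "expo \<beta> (Suc i) \<le> expo \<beta> i + 10"
proof -
  have "expo \<beta> i \<le> expo \<beta> (Suc i) \<and> expo \<beta> (Suc i) \<le> expo \<beta> i + 10"
  proof (cases "i = 0")
    case True
    have "block 1 = 0" by (rule block_eq) auto
    with True show ?thesis by (simp add: expo_0) (simp add: expo_def dip_def)
  next
    case False
    define n where "n = block i"
    have n: "8 ^ n \<le> i" "i < 8 ^ Suc n" unfolding n_def using False by (auto intro: block_bounds simp del: power_Suc)
    show ?thesis
    proof (cases "Suc i < 8 ^ Suc n")
      case True
      then have "block (Suc i) = n" using n by (intro block_eq) auto
      then show ?thesis using dip_step[of n i] unfolding expo_def n_def[symmetric] abs_le_iff by simp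
    next
      case False
      then have i: "Suc i = 8 ^ Suc n" using n by simp
      have "block (Suc i) = Suc n" unfolding i by (rule block_eq) auto
      moreover have "dip (Suc n) (Suc i) = 0" unfolding i by (rule dip_start)
      moreover have "dip n i = 0"
      proof (rule dip_eq_0)
        have "int i = 8 * 8 ^ n - 1" using arg_cong[OF i, of int] by simp
        then show "8 ^ n + 16 * int n \<le> int i" using dip_fits[of n] by linarith
      qed
      ultimately show ?thesis using assms by (simp add: expo_def algebra_simps flip: n_def)
    qed
  qed
  then show "expo \<beta> i \<le> expo \<beta> (Suc i)" "expo \<beta> (Suc i) \<le> expo \<beta> i + 10" by auto
qed

lemma dyadic_counting_dyadic_count:
  assumes "-1 \<le> \<beta>" "\<beta> \<le> 9"
  shows "dyadic_counting (dyadic_count \<beta>) 1024"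
proof
  show "mono (dyadic_count \<beta>)"
    unfolding mono_iff_le_Suc dyadic_count_def
    using expo_step(1)[OF assms] by (auto intro!: power_increasing nat_mono)
  show "1 \<le> dyadic_count \<beta> 0" by (simp add: dyadic_count_def)
  show "dyadic_count \<beta> (Suc i) \<le> 1024 * dyadic_count \<beta> i" for i
  proof -
    have "nat (expo \<beta> (Suc i)) \<le> 10 + nat (expo \<beta> i)"
      using expo_step(2)[OF assms, of i] by simp
    then have "(2::nat) ^ nat (expo \<beta> (Suc i)) \<le> 2 ^ (10 + nat (expo \<beta> i))"
      by (intro power_increasing) auto
    then show ?thesis by (simp add: dyadic_count_def power_add)
  qed
  show "\<exists>i. k \<le> dyadic_count \<beta> i" for k
  proof
    \<comment> \<open>At the start of a block the tent vanishes, so the exponent is at least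
      \<open>8 ^ k - k\<close>, which exceeds \<open>k\<close>.\<close>
    have "block (8 ^ k) = k" by (rule block_eq) auto
    then have "expo \<beta> (8 ^ k) = 8 ^ k + \<beta> * int k" by (simp add: expo_def dip_start)
    moreover have "- int k \<le> \<beta> * int k"
      using mult_right_mono[OF assms(1), of "int k"] by simp
    ultimately have "k \<le> nat (expo \<beta> (8 ^ k))" using less_8_power[of k] by linarith
    also have "\<dots> \<le> dyadic_count \<beta> (8 ^ k)"
      unfolding dyadic_count_def by (rule less_imp_le[OF less_exp])
    finally show "k \<le> dyadic_count \<beta> (8 ^ k)" .
  qed
qed

section \<open>Divergence of the series and steepness of the counting function\<close>

lemma dyadic_count_eq_powi: "-1 \<le> \<beta> \<Longrightarrow> real (dyadic_count \<beta> i) = 2 powi expo \<beta> i"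
  using expo_nonneg[of \<beta> i] by (simp add: dyadic_count_def power_int_def)

lemma dyadic_count_ratio:
  assumes "-1 \<le> \<beta>"
  shows "real (dyadic_count \<beta> i) / 2 ^ i = 2 powi (\<beta> * int (block i) - dip (block i) i)"
    and "2 ^ i / real (dyadic_count \<beta> i) = 2 powi (dip (block i) i - \<beta> * int (block i))"
proof -
  have "2 ^ i = (2::real) powi int i" by simp
  then show "real (dyadic_count \<beta> i) / 2 ^ i = 2 powi (\<beta> * int (block i) - dip (block i) i)"
    "2 ^ i / real (dyadic_count \<beta> i) = 2 powi (dip (block i) i - \<beta> * int (block i))"
    unfolding dyadic_count_eq_powi[OF assms]
    by (simp_all add: power_int_diff[symmetric] expo_def del: power_int_of_nat)
qed

text \<open>Behind the tent of the n-th block every summand is at least \<open>2 powi (- n)\<close>,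
  and there are at least \<open>4 ^ n\<close> of them, so one block contributes at least
  \<open>2 ^ n\<close>.\<close>

lemma dyadic_count_sum_unbounded:
  assumes "-1 \<le> \<beta>"
  shows "\<exists>m. B \<le> (\<Sum>i<m. real (dyadic_count \<beta> i) / 2 ^ i)"
proof -
  obtain n where n: "B < 2 ^ n" using real_arch_pow[of 2 B] by auto
  let ?A = "{8 ^ n + 16 * n..<8 ^ Suc n}"
  have "2 powi (- int n) \<le> real (dyadic_count \<beta> i) / 2 ^ i" if "i \<in> ?A" for i
  proof -
    have "block i = n" using that by (intro block_eq) auto
    moreover have "int (8 ^ n + 16 * n) \<le> int i"
      using that by (simp only: of_nat_le_iff atLeastLessThan_iff)
    then have "dip n i = 0" by (intro dip_eq_0) simp
    moreover have "- int n \<le> \<beta> * int n"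
      using mult_right_mono[OF assms, of "int n"] by simp
    ultimately show ?thesis by (simp add: dyadic_count_ratio[OF assms] power_int_increasing del: power_int_minus)
  qed
  then have "real (card ?A) * 2 powi (- int n) \<le> (\<Sum>i\<in>?A. real (dyadic_count \<beta> i) / 2 ^ i)"
    by (intro sum_bounded_below)
  also have "\<dots> \<le> (\<Sum>i<8 ^ Suc n. real (dyadic_count \<beta> i) / 2 ^ i)"
    by (intro sum_mono2) auto
  finally have "real (card ?A) * 2 powi (- int n) \<le> (\<Sum>i<8 ^ Suc n. real (dyadic_count \<beta> i) / 2 ^ i)" .
  moreover have "2 ^ n \<le> real (card ?A) * 2 powi (- int n)"
  proof -
    have "int (8 ^ n + 16 * n + 4 ^ n) \<le> int (8 ^ Suc n)" using block_length[of n] by simp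
    then have "8 ^ n + 16 * n + 4 ^ n \<le> (8 ^ Suc n :: nat)" by (simp only: of_nat_le_iff)
    then have "4 ^ n \<le> card ?A" unfolding card_atLeastLessThan
      by (intro add_le_imp_le_diff) (simp only: ac_simps)
    then have "4 ^ n \<le> real (card ?A)" by (metis of_nat_le_iff of_nat_numeral of_nat_power)
    moreover have "(4::real) ^ n = 2 ^ n * 2 ^ n" by (simp flip: power_mult_distrib)
    ultimately have "(2 ^ n * 2 ^ n) * 2 powi (- int n) \<le> real (card ?A) * 2 powi (- int n)"
      by (intro mult_right_mono) auto
    moreover have "(2 ^ n * 2 ^ n) * 2 powi (- int n) = (2::real) ^ n"
      by (simp add: power_int_minus)
    ultimately show ?thesis by (simp only:)
  qed
  ultimately have "B \<le> (\<Sum>i<8 ^ Suc n. real (dyadic_count \<beta> i) / 2 ^ i)" using n by linarith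
  then show ?thesis by blast
qed

lemma dyadic_count_steep:
  assumes "-1 \<le> \<beta>"
  shows "\<exists>i\<ge>i0. \<exists>n. K * 3 ^ Suc n * (real i * real (dyadic_count \<beta> i)) < real (dyadic_count \<beta> (i + n))"
proof -
  \<comment> \<open>Over \<open>8 * m\<close> steps the gain is
    \<open>4 ^ (8 * m) = 65536 ^ m\<close>. The cost is \<open>3 ^ (8 * m)\<close> times
    \<open>i\<close>, of order \<open>8 ^ m\<close>, together \<open>52488 ^ m\<close>; the tent
    height wins because \<open>(4/3) ^ 8 > 8\<close>. The 27 collects \<open>3\<close> from
    \<open>Suc\<close> and \<open>9\<close> from \<open>i \<le> 9 * 8 ^ m\<close>.\<close>
  obtain m0 where m0: "27 * \<bar>K\<bar> < (65536 / 52488) ^ m0"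
    using real_arch_pow[of "65536 / 52488" "27 * \<bar>K\<bar>"] by auto
  define m where "m = m0 + i0"
  \<comment> \<open>The run starts at the peak of the tent: over the next \<open>8 * m\<close>
    indices the tent falls to 0 while \<open>i\<close> grows, so the exponent gains 2 per
    step.\<close>
  define i where "i = 8 ^ m + 8 * m"
  have "27 * \<bar>K\<bar> < (65536 / 52488 :: real) ^ m"
    using m0 power_increasing[of m0 m "65536 / 52488 :: real"] by (simp only: m_def) linarith
  then have K: "27 * \<bar>K\<bar> * 52488 ^ m < 65536 ^ m"
    unfolding power_divide by (subst (asm) pos_less_divide_eq) (simp, assumption)
  have "int (i + 8 * m) < int (8 ^ Suc m)" using dip_fits[of m] by (simp add: i_def)
  then have len: "i + 8 * m < 8 ^ Suc m" by (simp only: of_nat_less_iff)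
  have "block i = m" "block (i + 8 * m) = m"
    by (rule block_eq; use len in \<open>simp add: i_def\<close>)+
  then have "expo \<beta> (i + 8 * m) = expo \<beta> i + int (16 * m)"
    using dip_eq_0[of m "i + 8 * m"] by (simp add: expo_def i_def dip_bottom)
  then have "nat (expo \<beta> (i + 8 * m)) = nat (expo \<beta> i) + 16 * m"
    using expo_nonneg[OF assms, of i] by linarith
  then have rise: "dyadic_count \<beta> (i + 8 * m) = dyadic_count \<beta> i * 2 ^ (16 * m)"
    unfolding dyadic_count_def by (simp only: power_add)
  have "i \<le> 9 * 8 ^ m"
    unfolding i_def using le_8_power[of m] by linarith
  then have "real i \<le> real (9 * 8 ^ m)" by (simp only: of_nat_le_iff)
  then have i_le: "real i \<le> 9 * 8 ^ m" by simp
  have "K * 3 ^ Suc (8 * m) * real i \<le> \<bar>K\<bar> * 3 ^ Suc (8 * m) * (9 * 8 ^ m)"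
    using i_le by (intro mult_mono) auto
  also have "\<dots> = 27 * \<bar>K\<bar> * (3 ^ (8 * m) * 8 ^ m)"
    by simp
  also have "(3::real) ^ (8 * m) * 8 ^ m = 52488 ^ m"
    by (simp only: power_mult power_mult_distrib[symmetric]) simp
  also note K
  also have "(65536::real) ^ m = 2 ^ (16 * m)" by (simp only: power_mult) simp
  finally have "K * 3 ^ Suc (8 * m) * real i * real (dyadic_count \<beta> i) < 2 ^ (16 * m) * real (dyadic_count \<beta> i)"
    by (intro mult_strict_right_mono) (auto simp: dyadic_count_def)
  also have "\<dots> = real (dyadic_count \<beta> (i + 8 * m))"
    unfolding rise by simp
  finally have "K * 3 ^ Suc (8 * m) * (real i * real (dyadic_count \<beta> i)) < real (dyadic_count \<beta> (i + 8 * m))"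
    by (simp only: mult.assoc)
  moreover have "i0 \<le> i" by (simp add: i_def m_def)
  ultimately show ?thesis by blast
qed

section \<open>The three examples\<close>

definition example_seq :: "int \<Rightarrow> nat \<Rightarrow> real" where
  "example_seq \<beta> = dyadic_counting.M (dyadic_count \<beta>)"

lemma example_seq:
  assumes "-1 \<le> \<beta>" "\<beta> \<le> 9"
  shows "example_seq \<beta> \<in> LC \<and> BMT_weight_function (assoc_weight (example_seq \<beta>)) \<and>
    normalized_weight (assoc_weight (example_seq \<beta>)) \<and>
    quasianalytic_weight (assoc_weight (example_seq \<beta>)) \<and>
    (\<nexists>\<sigma>. weight_function \<sigma> \<and> almost_subadditive \<sigma> \<and> equivalent_weights \<sigma> (assoc_weight (example_seq \<beta>)))"
proof -
  interpret dyadic_counting "dyadic_count \<beta>" 1024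
    by (rule dyadic_counting_dyadic_count[OF assms])
  show ?thesis
    unfolding example_seq_def
    using M_in_LC BMT normalized quasianalytic[OF dyadic_count_sum_unbounded[OF assms(1)]]
      no_almost_subadditive[OF dyadic_count_steep[OF assms(1)]]
    by blast
qed

text \<open>The tent is at most \<open>8 * n\<close>, so with \<open>\<beta> = 9\<close> the
  exponent of \<open>2 ^ i / N i\<close> is at most \<open>-n\<close> throughout the n-th
  block.\<close>

lemma example_seq_tendsto_0: "(\<lambda>k. quotient_seq (example_seq 9) k / real k) \<longlonglongrightarrow> 0"
proof -
  interpret dyadic_counting "dyadic_count 9" 1024
    by (rule dyadic_counting_dyadic_count) auto
  show ?thesis unfolding example_seq_def
  proof (rule quotient_tendsto_0, rule real_tendsto_sandwich[OF _ _ tendsto_const])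
    show "(\<lambda>i. (1/2) ^ block i :: real) \<longlonglongrightarrow> 0"
      by (rule filterlim_compose[OF LIMSEQ_power_zero block_at_top]) simp
    show "\<forall>\<^sub>F i in sequentially. 2 ^ i / real (dyadic_count 9 i) \<le> (1/2) ^ block i"
    proof (intro always_eventually allI)
      fix i
      have "(2::real) powi (dip (block i) i - 9 * int (block i)) \<le> 2 powi (- int (block i))"
        using dip_le_depth[of "block i" i] by (intro power_int_increasing) auto
      then show "2 ^ i / real (dyadic_count 9 i) \<le> (1/2) ^ block i"
        by (simp add: dyadic_count_ratio power_int_minus power_divide field_simps)
    qed
  qed auto
qed

text \<open>The tent is nonnegative, so with \<open>\<beta> = -1\<close> the exponent of
  \<open>2 ^ i / N i\<close> is at least \<open>n\<close> throughout the n-th block.\<close>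

lemma example_seq_at_top: "filterlim (\<lambda>k. quotient_seq (example_seq (-1)) k / real k) at_top sequentially"
proof -
  interpret dyadic_counting "dyadic_count (-1)" 1024
    by (rule dyadic_counting_dyadic_count) auto
  show ?thesis unfolding example_seq_def
  proof (rule quotient_at_top, rule filterlim_at_top_mono)
    show "filterlim (\<lambda>i. real (block i)) at_top sequentially"
      by (rule filterlim_compose[OF filterlim_real_sequentially block_at_top])
    show "\<forall>\<^sub>F i in sequentially. real (block i) \<le> 2 ^ i / real (dyadic_count (-1) i)"
    proof (intro always_eventually allI)
      fix i
      have "real (block i) \<le> 2 powi int (block i)"
        using of_nat_less_two_power[of "block i", where 'a=real] by simp
      also have "(2::real) powi int (block i) \<le> 2 powi (dip (block i) i + int (block i))"
        using dip_nonneg[of "block i" i] by (intro power_int_increasing) auto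
      finally show "real (block i) \<le> 2 ^ i / real (dyadic_count (-1) i)"
        by (simp add: dyadic_count_ratio)
    qed
  qed
qed

text \<open>With \<open>\<beta> = 4\<close> the exponent of \<open>2 ^ i / N i\<close> is
  \<open>-4 * n\<close> at the start of the n-th block and \<open>8 * n - 4 * n\<close> at the peak
  of the tent.\<close>

lemma example_seq_oscillating:
  "liminf (\<lambda>k. ereal (quotient_seq (example_seq 4) k / real k)) = 0"
  "limsup (\<lambda>k. ereal (quotient_seq (example_seq 4) k / real k)) = \<infinity>"
proof -
  interpret dyadic_counting "dyadic_count 4" 1024
    by (rule dyadic_counting_dyadic_count) auto
  show "liminf (\<lambda>k. ereal (quotient_seq (example_seq 4) k / real k)) = 0"
    unfolding example_seq_def
  proof (rule liminf_quotient_0)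
    fix e :: real and i0 :: nat
    assume "0 < e"
    then obtain m where m: "(1/16) ^ m < e" using real_arch_pow_inv[of e "1/16"] by auto
    define n where "n = m + i0"
    have "block (8 ^ n) = n" by (rule block_eq) auto
    then have "2 ^ (8 ^ n) / real (dyadic_count 4 (8 ^ n)) = 2 powi (- int (4 * n))"
      by (simp add: dyadic_count_ratio dip_start)
    also have "\<dots> = (1/16) ^ n"
      unfolding power_int_minus power_int_of_nat by (simp add: power_mult power_divide inverse_eq_divide)
    also have "\<dots> \<le> (1/16) ^ m" by (rule power_decreasing) (auto simp: n_def)
    finally have "2 ^ (8 ^ n) / real (dyadic_count 4 (8 ^ n)) < e" using m by simp
    moreover have "i0 \<le> 8 ^ n" using le_8_power[of n] unfolding n_def by linarith
    ultimately show "\<exists>i\<ge>i0. 2 ^ i / real (dyadic_count 4 i) < e" by blast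
  qed
  show "limsup (\<lambda>k. ereal (quotient_seq (example_seq 4) k / real k)) = \<infinity>"
    unfolding example_seq_def
  proof (rule limsup_quotient_infinity)
    fix K :: real and i0 :: nat
    obtain m where m: "K < 16 ^ m" using real_arch_pow[of 16 K] by auto
    define n where "n = m + i0"
    let ?i = "8 ^ n + 8 * n"
    have "int (8 * n) < int (7 * 8 ^ n)" using dip_fits[of n] by simp
    then have "8 * n < 7 * 8 ^ n" by (simp only: of_nat_less_iff)
    then have "block ?i = n" by (intro block_eq) auto
    then have "2 ^ ?i / real (dyadic_count 4 ?i) = 2 powi (int (4 * n))"
      by (simp add: dyadic_count_ratio dip_bottom)
    also have "\<dots> = 2 ^ (4 * n)" by (rule power_int_of_nat)
    also have "\<dots> = 16 ^ n" by (simp add: power_mult)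
    finally have "16 ^ m \<le> 2 ^ ?i / real (dyadic_count 4 ?i)"
      using power_increasing[of m n "16::real"] by (simp add: n_def)
    with m have "K < 2 ^ ?i / real (dyadic_count 4 ?i)" by linarith
    moreover have "i0 \<le> ?i" using le_8_power[of n] by (simp add: n_def)
    ultimately show "\<exists>i\<ge>i0. K < 2 ^ i / real (dyadic_count 4 i)" by blast
  qed
qed

theorem theorem3p7:
  shows "(\<exists>M. M \<in> LC \<and> BMT_weight_function (assoc_weight M) \<and>
            normalized_weight (assoc_weight M) \<and> quasianalytic_weight (assoc_weight M) \<and>
            (\<nexists>\<sigma>. weight_function \<sigma> \<and> almost_subadditive \<sigma> \<and>
                 equivalent_weights \<sigma> (assoc_weight M))) \<and>
         (\<exists>M. M \<in> LC \<and> BMT_weight_function (assoc_weight M) \<and>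
            normalized_weight (assoc_weight M) \<and> quasianalytic_weight (assoc_weight M) \<and>
            (\<nexists>\<sigma>. weight_function \<sigma> \<and> almost_subadditive \<sigma> \<and>
                 equivalent_weights \<sigma> (assoc_weight M)) \<and>
            (\<lambda>k. quotient_seq M k / real k) \<longlonglongrightarrow> 0) \<and>
         (\<exists>M. M \<in> LC \<and> BMT_weight_function (assoc_weight M) \<and>
            normalized_weight (assoc_weight M) \<and> quasianalytic_weight (assoc_weight M) \<and>
            (\<nexists>\<sigma>. weight_function \<sigma> \<and> almost_subadditive \<sigma> \<and>
                 equivalent_weights \<sigma> (assoc_weight M)) \<and>
            filterlim (\<lambda>k. quotient_seq M k / real k) at_top sequentially) \<and>
         (\<exists>M. M \<in> LC \<and> BMT_weight_function (assoc_weight M) \<and>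
            normalized_weight (assoc_weight M) \<and> quasianalytic_weight (assoc_weight M) \<and>
            (\<nexists>\<sigma>. weight_function \<sigma> \<and> almost_subadditive \<sigma> \<and>
                 equivalent_weights \<sigma> (assoc_weight M)) \<and>
            liminf (\<lambda>k. ereal (quotient_seq M k / real k)) = 0 \<and>
            limsup (\<lambda>k. ereal (quotient_seq M k / real k)) = \<infinity>)"
proof -
  have "-1 \<le> (9::int)" "-1 \<le> (4::int)" "(-1::int) \<le> 9" "(4::int) \<le> 9" by simp_all
  note a = example_seq[OF this(1) order_refl] and b = example_seq[OF order_refl this(3)]
    and c = example_seq[OF this(2,4)]
  show ?thesis
    \<comment> \<open>The first claim puts no condition on the quotients, so the sequence of case
      (a) serves it as well.\<close>
    apply (rule conjI, rule exI[of _ "example_seq 9"], rule a)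
    apply (rule conjI, rule exI[of _ "example_seq 9"], simp only: a example_seq_tendsto_0 simp_thms)
    apply (rule conjI, rule exI[of _ "example_seq (-1)"], simp only: b example_seq_at_top simp_thms)
    apply (rule exI[of _ "example_seq 4"], simp only: c example_seq_oscillating simp_thms)
    done
qed

end
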